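(* Let $f:\mathbb{R}^N\to\mathbb{R}$ and $\mathbf{g}=(g_1,\dots,g_m):\mathbb{R}^N\to\mathbb{R}^m$ be smooth, and consider the problem $$\text{Minimize in } \mathbf{x}\in\mathbb{R}^N:\quad f(\mathbf{x})\quad\text{subject to}\quad \mathbf{g}(\mathbf{x})\le\mathbf{0}.\qquad (P)$$ Assume that $L(\mathbf{x},\mathbf{y})=f(\mathbf{x})+\sum_{k=1}^m e^{y^{(k)}g_k(\mathbf{x})}$ is strictly convex and coercive in $\mathbf{x}$ for all $\mathbf{y}\in\mathbb{R}^m_+$, and let $\mathbf{G}:\overline{\mathbb{R}^m_+}\to\overline{\mathbb{R}^m_+}$ be the associated map defined in the context. Suppose that $\overline{\mathbf{y}}\in\overline{\mathbb{R}^m_+}$ is a locally stable fixed point of $\mathbf{G}$, in the sense that $\mathbf{G}(\overline{\mathbf{y}})=\overline{\mathbf{y}}$ and the iterates of $\mathbf{G}$ starting from any point in some neighborhood of $\overline{\mathbf{y}}$ in $\overline{\mathbb{R}^m_+}$ converge to $\overline{\mathbf{y}}$. Then $\overline{\mathbf{x}}=\mathbf{x}(\overline{\mathbf{y}})$ is a (local) solution of $(P)$, whether or not it satisfies the Karush-Kuhn-Tucker optimality conditions for $(P)$ (existence of $\mathbf{y}\ge\mathbf{0}$ with $\nabla f(\overline{\mathbf{x}})+\mathbf{y}\cdot\nabla\mathbf{g}(\overline{\mathbf{x}})=\mathbf{0}$, $\mathbf{y}\cdot\mathbf{g}(\overline{\mathbf{x}})=0$, $\mathbf{g}(\overline{\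mathbf{x}})\le\mathbf{0}$).
   Context: Notation: $\mathbb{R}^m_+=\{\mathbf{y}\in\mathbb{R}^m: y^{(k)}>0\text{ for all }k\}$ and $\overline{\mathbb{R}^m_+}=\{\mathbf{y}\in\mathbb{R}^m: y^{(k)}\ge0\text{ for all }k\}$; vector inequalities are componentwise. A function is coercive in $\mathbf{x}$ if it tends to $+\infty$ as $|\mathbf{x}|\to\infty$. For $\mathbf{y}\in\mathbb{R}^m_+$, $\mathbf{x}(\mathbf{y})$ is the unique global minimizer of $L(\cdot,\mathbf{y})$ over $\mathbb{R}^N$. The map $\mathbf{G}=(G_k)_{k=1,\dots,m}$ is defined on $\mathbb{R}^m_+$ by $$G_k(\mathbf{y})=y^{(k)}e^{y^{(k)}g_k(\mathbf{x}(\mathbf{y}))},$$ and is extended by continuity to $\overline{\mathbb{R}^m_+}$. It is a standing assumption that this continuous extension is possible: for $\mathbf{y}\in\overline{\mathbb{R}^m_+}\setminus\mathbb{R}^m_+$, the value $\mathbf{G}(\mathbf{y})$ is the limit of $\mathbf{G}(\mathbf{y}_j)$ for $\mathbf{y}_j\in\mathbb{R}^m_+$, $\mathbf{y}_j\to\mathbf{y}$; likewise $\mathbf{y}\mapsto\mathbf{x}(\mathbf{y})$ is taken to be extended continuously, so that $\mathbf{x}(\mathbf{y})=\lim\mathbf{x}(\mathbf{y}_j)$ at such boundary points. *)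

theory Defs
  imports "HOL-Analysis.Analysis"
begin

text \<open>
  On a finite-dimensional domain, a map is of class \<open>C\<^sup>k\<^sup>+\<^sup>1\<close> iff it is differentiable and
  each of its directional derivatives is of class \<open>C\<^sup>k\<close>.
\<close>

fun C_class :: "nat \<Rightarrow> ('a::euclidean_space \<Rightarrow> 'b::euclidean_space) \<Rightarrow> bool" where
  "C_class 0 h \<longleftrightarrow> continuous_on UNIV h"
| "C_class (Suc k) h \<longleftrightarrow>
     h differentiable_on UNIV \<and> (\<forall>v. C_class k (\<lambda>x. frechet_derivative h (at x) v))"

definition smooth :: "('a::euclidean_space \<Rightarrow> 'b::euclidean_space) \<Rightarrow> bool" where
  "smooth h \<longleftrightarrow> (\<forall>k. C_class k h)"

definition strictly_convex :: "('a::real_vector \<Rightarrow> real) \<Rightarrow> bool" where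
  "strictly_convex h \<longleftrightarrow>
     (\<forall>x z t. x \<noteq> z \<longrightarrow> 0 < t \<longrightarrow> t < 1 \<longrightarrow>
        h ((1 - t) *\<^sub>R x + t *\<^sub>R z) < (1 - t) * h x + t * h z)"

definition coercive :: "('a::real_normed_vector \<Rightarrow> real) \<Rightarrow> bool" where
  "coercive h \<longleftrightarrow> filterlim h at_top at_infinity"

definition pos_orthant :: "(real ^ 'm) set" where
  "pos_orthant = {y. \<forall>k. 0 < y $ k}"

definition nonneg_orthant :: "(real ^ 'm) set" where
  "nonneg_orthant = {y. \<forall>k. 0 \<le> y $ k}"

definition feasible :: "(real ^ 'n \<Rightarrow> real ^ 'm) \<Rightarrow> (real ^ 'n) set" where
  "feasible g = {x. \<forall>k. g x $ k \<le> 0}"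

definition local_solution ::
  "(real ^ 'n \<Rightarrow> real) \<Rightarrow> (real ^ 'n \<Rightarrow> real ^ 'm) \<Rightarrow> real ^ 'n \<Rightarrow> bool" where
  "local_solution f g x \<longleftrightarrow>
     x \<in> feasible g \<and> (\<exists>U. open U \<and> x \<in> U \<and> (\<forall>z \<in> U \<inter> feasible g. f x \<le> f z))"

definition L ::
  "(real ^ 'n \<Rightarrow> real) \<Rightarrow> (real ^ 'n \<Rightarrow> real ^ 'm) \<Rightarrow> real ^ 'n \<Rightarrow> real ^ 'm \<Rightarrow> real" where
  "L f g x y = f x + (\<Sum>k\<in>UNIV. exp (y $ k * g x $ k))"

text \<open>The maps with suffix \<open>_int\<close> are meaningful on \<^const>\<open>pos_orthant\<close> only.\<close>

definition x_int ::
  "(real ^ 'n \<Rightarrow> real) \<Rightarrow> (real ^ 'n \<Rightarrow> real ^ 'm) \<Rightarrow> real ^ 'm \<Rightarrow> real ^ 'n" where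
  "x_int f g y = (THE x. is_arg_min (\<lambda>x. L f g x y) (\<lambda>_. True) x)"

definition G_int ::
  "(real ^ 'n \<Rightarrow> real) \<Rightarrow> (real ^ 'n \<Rightarrow> real ^ 'm) \<Rightarrow> real ^ 'm \<Rightarrow> real ^ 'm" where
  "G_int f g y = (\<chi> k. y $ k * exp (y $ k * g (x_int f g y) $ k))"

definition extendable :: "(real ^ 'm \<Rightarrow> 'b::t2_space) \<Rightarrow> bool" where
  "extendable h \<longleftrightarrow>
     (\<forall>y \<in> nonneg_orthant - pos_orthant. \<exists>l. (h \<longlongrightarrow> l) (at y within pos_orthant))"

definition extension :: "(real ^ 'm \<Rightarrow> 'b::t2_space) \<Rightarrow> real ^ 'm \<Rightarrow> 'b" where
  "extension h y = (if y \<in> pos_orthant then h y else Lim (at y within pos_orthant) h)"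

definition x_map ::
  "(real ^ 'n \<Rightarrow> real) \<Rightarrow> (real ^ 'n \<Rightarrow> real ^ 'm) \<Rightarrow> real ^ 'm \<Rightarrow> real ^ 'n" where
  "x_map f g = extension (x_int f g)"

definition G_map ::
  "(real ^ 'n \<Rightarrow> real) \<Rightarrow> (real ^ 'n \<Rightarrow> real ^ 'm) \<Rightarrow> real ^ 'm \<Rightarrow> real ^ 'm" where
  "G_map f g = extension (G_int f g)"

definition locally_stable_fixed_point :: "(real ^ 'm \<Rightarrow> real ^ 'm) \<Rightarrow> real ^ 'm \<Rightarrow> bool" where
  "locally_stable_fixed_point G y \<longleftrightarrow>
     G y = y \<and>
     (\<exists>U. open U \<and> y \<in> U \<and> (\<forall>z \<in> U \<inter> nonneg_orthant. (\<lambda>j. (G ^^ j) z) \<longlonglongrightarrow> y))"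

end

theory Submission
  imports Defs
begin

text \<open>
  Follow an orbit \<open>y\<^sub>j\<close> of \<open>G\<close> in the open orthant with \<open>y\<^sub>j \<longlonglongrightarrow> y\<close> and \<open>x(y\<^sub>j) \<longlonglongrightarrow> x\<close>.
  Passing to the limit in the iteration gives \<open>y\<^sup>k = y\<^sup>k exp (y\<^sup>k g\<^sub>k(x))\<close>, that is,
  complementarity \<open>y\<^sup>k g\<^sub>k(x) = 0\<close>. If \<open>g\<^sub>k(x) > 0\<close>, then \<open>y\<^sup>k = 0\<close>, although the positive
  sequence \<open>y\<^sub>j\<^sup>k\<close> is eventually increasing; hence \<open>x\<close> is feasible. For feasible \<open>z\<close>, minimality of
  \<open>x(y\<^sub>j)\<close> gives \<open>L(x(y\<^sub>j), y\<^sub>j) \<le> L(z, y\<^sub>j) \<le> f(z) + m\<close>, and by complementarity the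
  left-hand side tends to \<open>f(x) + m\<close>. Thus \<open>x\<close> is even a global solution.
\<close>

lemma coercive_attains_inf:
  fixes h :: "'a::euclidean_space \<Rightarrow> real"
  assumes cont: "continuous_on UNIV h" and "coercive h"
  obtains x where "\<And>z. h x \<le> h z"
proof -
  have "\<forall>\<^sub>F z in at_infinity. h 0 \<le> h z"
    using assms(2) unfolding coercive_def filterlim_at_top by blast
  then obtain b where b: "\<And>z. b \<le> norm z \<Longrightarrow> h 0 \<le> h z"
    unfolding eventually_at_infinity by blast
  \<comment> \<open>The radius \<open>max b 0\<close> keeps the ball nonempty with \<open>0\<close>
    inside it, so the minimum over the ball is at most \<open>h 0\<close>, which bounds
    \<open>h\<close> from below outside.\<close>
  obtain x where x: "\<And>z. z \<in> cball 0 (max b 0) \<Longrightarrow> h x \<le> h z"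
    using continuous_attains_inf[of "cball 0 (max b 0)" h] continuous_on_subset[OF cont]
    by (metis compact_cball cball_eq_empty max.cobounded2 not_less subset_UNIV)
  have "h x \<le> h z" for z
  proof (cases "z \<in> cball 0 (max b 0)")
    case False
    then have "h 0 \<le> h z" by (intro b) auto
    moreover have "h x \<le> h 0" by (intro x) auto
    ultimately show ?thesis by simp
  qed (rule x)
  then show thesis by (rule that)
qed

lemma strictly_convex_minimizer_unique:
  assumes sc: "strictly_convex h" and x: "\<And>z. h x \<le> h z" and y: "\<And>z. h y \<le> h z"
  shows "x = y"
proof (rule ccontr)
  assume "x \<noteq> y"
  then have "h ((1 - 1/2) *\<^sub>R x + (1/2) *\<^sub>R y) < (1 - 1/2) * h x + 1/2 * h y"
    by (intro sc[unfolded strictly_convex_def, rule_format]) simp_all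
  also have "\<dots> = h x"
    using x[of y] y[of x] by simp
  finally show False
    using x by (simp add: not_less[symmetric])
qed

lemma smooth_imp_continuous_on: "smooth h \<Longrightarrow> continuous_on UNIV h"
  unfolding smooth_def using C_class.simps(1) by blast

text \<open>The description in \<open>x_int\<close> is proper: coercivity and continuity give a
  minimizer, and strict convexity makes it unique.\<close>

lemma L_x_int_le:
  fixes f :: "real ^ 'n \<Rightarrow> real" and g :: "real ^ 'n \<Rightarrow> real ^ 'm"
  assumes f: "continuous_on UNIV f" and g: "continuous_on UNIV g"
    and sc: "strictly_convex (\<lambda>x. L f g x y)" and co: "coercive (\<lambda>x. L f g x y)"
  shows "L f g (x_int f g y) y \<le> L f g z y"
proof -
  have "continuous_on UNIV (\<lambda>x. L f g x y)"
    unfolding L_def by (intro continuous_intros f g)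
  from coercive_attains_inf[OF this co] obtain x where x: "\<And>z. L f g x y \<le> L f g z y"
    by blast
  have "is_arg_min (\<lambda>x. L f g x y) (\<lambda>_. True) (x_int f g y)"
    unfolding x_int_def
  proof (rule theI)
    show "is_arg_min (\<lambda>x. L f g x y) (\<lambda>_. True) x"
      using x by (simp add: is_arg_min_linorder)
    show "x' = x" if "is_arg_min (\<lambda>x. L f g x y) (\<lambda>_. True) x'" for x'
      using strictly_convex_minimizer_unique[OF sc _ x] that
      by (simp add: is_arg_min_linorder)
  qed
  then show ?thesis by (simp add: is_arg_min_linorder)
qed

text \<open>Adding small positive multiples of the all-ones vector \<open>1\<close> leads from a
  boundary point into the open orthant. This makes the filter in \<open>extension\<close>
  nontrivial, so that \<open>Lim\<close> is determined there.\<close>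

lemma nonneg_orthant_islimpt:
  fixes y :: "real ^ 'm"
  assumes y: "y \<in> nonneg_orthant" "y \<notin> pos_orthant"
  shows "y islimpt pos_orthant"
  unfolding islimpt_sequential
proof (intro exI conjI allI)
  let ?s = "\<lambda>j. y + (1 / real (Suc j)) *\<^sub>R 1"
  show pos: "?s j \<in> pos_orthant - {y}" for j
  proof -
    have "?s j \<in> pos_orthant"
      using y(1) by (auto simp: pos_orthant_def nonneg_orthant_def intro: add_nonneg_pos)
    with y(2) show ?thesis by (metis DiffI singletonD)
  qed
  have "(\<lambda>j. y + (1 / real (Suc j)) *\<^sub>R 1) \<longlonglongrightarrow> y + 0 *\<^sub>R 1"
    by (intro tendsto_intros lim_inverse_n'[THEN LIMSEQ_Suc])
  then show "?s \<longlonglongrightarrow> y" by simp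
qed

lemma tendsto_extension:
  fixes h :: "real ^ 'm \<Rightarrow> 'b::t2_space"
  assumes "extendable h" "y \<in> nonneg_orthant" "y \<notin> pos_orthant"
  shows "(h \<longlongrightarrow> extension h y) (at y within pos_orthant)"
proof -
  obtain l where l: "(h \<longlongrightarrow> l) (at y within pos_orthant)"
    using assms unfolding extendable_def by blast
  moreover have "Lim (at y within pos_orthant) h = l"
    using nonneg_orthant_islimpt[OF assms(2,3)] l
    by (intro tendsto_Lim) (simp_all add: trivial_limit_within)
  ultimately show ?thesis
    using assms(3) by (simp add: extension_def)
qed

lemma G_int_pos_orthant: "y \<in> pos_orthant \<Longrightarrow> G_int f g y \<in> pos_orthant"
  by (simp add: pos_orthant_def G_int_def)

lemma G_map_funpow_pos_orthant:
  assumes "z \<in> pos_orthant"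
  shows "(G_map f g ^^ j) z \<in> pos_orthant"
proof (induction j)
  case (Suc j)
  then show ?case
    by (simp add: G_map_def extension_def G_int_pos_orthant)
qed (simp add: assms)

text \<open>The limits \<open>y\<close> and \<open>x\<close> are arbitrary here, so the lemma serves
  both a constant orbit at an interior fixed point and an orbit approaching a boundary one.\<close>

lemma orbit_limit_optimal:
  fixes f :: "real ^ 'n \<Rightarrow> real" and g :: "real ^ 'n \<Rightarrow> real ^ 'm"
  assumes f: "continuous_on UNIV f" and g: "continuous_on UNIV g"
    and min: "\<And>y z. y \<in> pos_orthant \<Longrightarrow> L f g (x_int f g y) y \<le> L f g z y"
    and pos: "\<And>j. Y j \<in> pos_orthant"
    and iter: "\<And>j. Y (Suc j) = G_int f g (Y j)"
    and Y: "Y \<longlonglongrightarrow> y" and X: "(\<lambda>j. x_int f g (Y j)) \<longlonglongrightarrow> x"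
  shows "x \<in> feasible g" and "z \<in> feasible g \<Longrightarrow> f x \<le> f z"
proof -
  let ?X = "\<lambda>j. x_int f g (Y j)"
  have fX: "(\<lambda>j. f (?X j)) \<longlonglongrightarrow> f x" and "(\<lambda>j. g (?X j)) \<longlonglongrightarrow> g x"
    using f g X by (auto intro: continuous_on_tendsto_compose)
  then have gX: "(\<lambda>j. g (?X j) $ k) \<longlonglongrightarrow> g x $ k" for k
    by (auto intro: tendsto_intros)
  have Yk: "(\<lambda>j. Y j $ k) \<longlonglongrightarrow> y $ k" for k
    using Y by (rule tendsto_vec_nth)
  have step: "Y (Suc j) $ k = Y j $ k * exp (Y j $ k * g (?X j) $ k)" for j k
    by (simp add: iter G_int_def)
  have Y_pos: "0 < Y j $ k" for j k
    using pos by (simp add: pos_orthant_def)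
  have compl: "y $ k * g x $ k = 0" for k
  proof -
    have "(\<lambda>j. Y (Suc j) $ k) \<longlonglongrightarrow> y $ k * exp (y $ k * g x $ k)"
      unfolding step by (intro tendsto_intros Yk gX)
    \<comment> \<open>The shifted sequence has the same limit; either \<open>y $ k\<close> vanishes
      or the exponential is 1, so its exponent is 0.\<close>
    then have "y $ k * exp (y $ k * g x $ k) = y $ k"
      using LIMSEQ_Suc[OF Yk] by (rule LIMSEQ_unique)
    then show ?thesis by auto
  qed
  have "g x $ k \<le> 0" for k
  proof (rule ccontr)
    assume "\<not> g x $ k \<le> 0"
    then have gpos: "0 < g x $ k" by simp
    with compl[of k] have "y $ k = 0" by simp
    from order_tendstoD(1)[OF gX gpos]
    obtain n where n: "\<And>j. n \<le> j \<Longrightarrow> 0 < g (?X j) $ k"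
      unfolding eventually_sequentially by blast
    have mono: "Y j $ k \<le> Y (Suc j) $ k" if "n \<le> j" for j
      unfolding step using Y_pos[of j k] n[OF that] by simp
    have "Y n $ k \<le> Y j $ k" if "n \<le> j" for j
      using that by (induction rule: dec_induct) (use mono in \<open>auto intro: order_trans\<close>)
    then have "Y n $ k \<le> y $ k"
      by (intro LIMSEQ_le_const[OF Yk]) blast
    with Y_pos[of n k] \<open>y $ k = 0\<close> show False by simp
  qed
  then show "x \<in> feasible g" by (simp add: feasible_def)
  assume z: "z \<in> feasible g"
  have bound: "L f g (?X j) (Y j) \<le> f z + CARD('m)" for j
  proof -
    have "exp (Y j $ k * g z $ k) \<le> 1" for k
      using Y_pos[of j k] z by (simp add: feasible_def mult_le_0_iff)
    then have "(\<Sum>k\<in>UNIV. exp (Y j $ k * g z $ k)) \<le> (\<Sum>k\<in>(UNIV::'m set). 1)"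
      by (intro sum_mono)
    then have "L f g z (Y j) \<le> f z + CARD('m)"
      by (simp add: L_def)
    with min[OF pos, of j z] show ?thesis by simp
  qed
  have "(\<lambda>j. L f g (?X j) (Y j)) \<longlonglongrightarrow> f x + (\<Sum>k\<in>UNIV. exp (y $ k * g x $ k))"
    unfolding L_def by (intro tendsto_intros fX Yk gX)
  then have "f x + (\<Sum>k\<in>UNIV. exp (y $ k * g x $ k)) \<le> f z + CARD('m)"
    using bound by (intro LIMSEQ_le_const2) auto
  \<comment> \<open>By \<open>compl\<close> each exponential is \<open>exp 0\<close>, so the sum
    equals \<open>CARD('m)\<close> and cancels.\<close>
  then show "f x \<le> f z" by (simp add: compl)
qed

theorem proposition1p1:
  fixes f :: "real ^ 'n \<Rightarrow> real"
    and g :: "real ^ 'n \<Rightarrow> real ^ 'm"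
    and ybar :: "real ^ 'm"
  assumes "smooth f"
    and "smooth g"
    and "\<And>y. y \<in> pos_orthant \<Longrightarrow> strictly_convex (\<lambda>x. L f g x y)"
    and "\<And>y. y \<in> pos_orthant \<Longrightarrow> coercive (\<lambda>x. L f g x y)"
    and "extendable (x_int f g)"
    and "extendable (G_int f g)"
    and "ybar \<in> nonneg_orthant"
    and "locally_stable_fixed_point (G_map f g) ybar"
  shows "local_solution f g (x_map f g ybar)"
proof -
  let ?Y = "\<lambda>z j. (G_map f g ^^ j) z"
  obtain U where fixed: "G_map f g ybar = ybar" and U: "open U" "ybar \<in> U"
    and conv: "\<And>z. z \<in> U \<inter> nonneg_orthant \<Longrightarrow> ?Y z \<longlonglongrightarrow> ybar"
    using assms(8) unfolding locally_stable_fixed_point_def by blast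
  \<comment> \<open>An interior \<open>ybar\<close> is its own constant orbit. At the boundary,
    stability supplies an orbit from a nearby positive point.\<close>
  have "\<exists>z\<in>pos_orthant. ?Y z \<longlonglongrightarrow> ybar \<and> (\<lambda>j. x_int f g (?Y z j)) \<longlonglongrightarrow> x_map f g ybar"
  proof (cases "ybar \<in> pos_orthant")
    case True
    have "?Y ybar j = ybar" for j
      by (induction j) (simp_all add: fixed)
    with True show ?thesis
      by (intro bexI[of _ ybar]) (simp_all add: x_map_def extension_def)
  next
    case False
    obtain z where z: "z \<in> pos_orthant" "z \<in> U"
      using islimptE[OF nonneg_orthant_islimpt[OF assms(7) False] U(2,1)] by blast
    then have "z \<in> nonneg_orthant"
      by (auto simp: pos_orthant_def nonneg_orthant_def intro: less_imp_le)
    with z conv have Y: "?Y z \<longlonglongrightarrow> ybar" by blast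
    have "?Y z j \<in> pos_orthant" for j
      using z(1) by (rule G_map_funpow_pos_orthant)
    \<comment> \<open>The orbit stays in the open orthant, which omits \<open>ybar\<close>, so it
      never hits \<open>ybar\<close> and the punctured limit defining \<open>x_map\<close>
      applies.\<close>
    with Y False have "filterlim (?Y z) (at ybar within pos_orthant) sequentially"
      by (auto simp: filterlim_at intro!: always_eventually)
    then have "(\<lambda>j. x_int f g (?Y z j)) \<longlonglongrightarrow> x_map f g ybar"
      unfolding x_map_def
      by (rule filterlim_compose[OF tendsto_extension[OF assms(5,7) False]])
    with Y z(1) show ?thesis by blast
  qed
  then obtain z where z: "z \<in> pos_orthant" and Y: "?Y z \<longlonglongrightarrow> ybar"
    and X: "(\<lambda>j. x_int f g (?Y z j)) \<longlonglongrightarrow> x_map f g ybar"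
    by blast
  note cont = assms(1,2)[THEN smooth_imp_continuous_on]
  have pos: "?Y z j \<in> pos_orthant" for j
    using z by (rule G_map_funpow_pos_orthant)
  have iter: "?Y z (Suc j) = G_int f g (?Y z j)" for j
    using pos[of j] by (simp add: G_map_def extension_def)
  note optimal = orbit_limit_optimal
    [OF cont L_x_int_le[OF cont assms(3,4)] pos iter Y X]
  \<comment> \<open>Optimality holds against all feasible points, so \<open>UNIV\<close> serves as
    the neighborhood.\<close>
  show ?thesis
    unfolding local_solution_def using optimal by (auto intro: exI[of _ UNIV])
qed

end
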